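(* Let $x,y\in\mathbb{R}^n$ with $x^Ty\neq 0$ and let $0<u<1$. Let the roundoffs $\delta_k$, $1\leq k\leq 2n-1$, be random variables with $\mathbb{E}[\delta_k]=0$ and $|\delta_k|\leq u$. Let $\hat{s}_{2n}=\mathrm{fl}(x^Ty)$ be the computed inner product defined by $\hat{s}_1=x_1y_1$, $\hat{s}_2=\hat{s}_1(1+\delta_1)$ and, for $2\leq k\leq n$, $$\hat{s}_{2k-1}=\hat{s}_{2k-2}+x_ky_k(1+\delta_{2k-2}),\qquad \hat{s}_{2k}=\hat{s}_{2k-1}(1+\delta_{2k-1}),$$ and let $s_{2n}=x^Ty$. Then for any $0<\delta<1$, with probability at least $1-\delta$, $$\left|\frac{\mathrm{fl}(x^Ty)-x^Ty}{x^Ty}\right|=\left|\frac{\hat{s}_{2n}-s_{2n}}{s_{2n}}\right|\leq\frac{\sqrt{\sum_{k=1}^{2n-1}c_k^2}}{|x^Ty|}\,\sqrt{2\ln(2/\delta)}\;u,$$ where $$c_{2k-1}=|x_1y_1|(1+u)^{k-1}+\sum_{j=2}^k|x_jy_j|(1+u)^{k-j+1},\quad 1\leq k\leq n,\qquad c_{2k-2}=|x_ky_k|,\quad 2\leq k\leq n.$$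
   Context: The recursion models the sequential (left to right) floating point accumulation of the inner product of two fixed vectors whose elements are stored exactly, with $n$ multiplications and $n-1$ additions each incurring one roundoff; $\mathrm{fl}(x^Ty)$ is simply notation for $\hat{s}_{2n}$. The scalar $\delta$ (failure probability) is unrelated to the random variables $\delta_k$.
   Formalization: The condition that each roundoff has mean zero is strengthened to conditional mean zero given the earlier roundoffs, E[δ_k | δ_1,…,δ_{k-1}] = 0 almost surely; with E[δ_k] = 0 alone the bound fails, e.g. n = 2, x = y = (1,1), u = 1/100, δ = 9/10, all δ_k equal to one fair random sign times u. *)

theory Defs
  imports "HOL-Probability.Probability"
begin

text \<open>
  Vectors in \<open>\<real>\<^sup>n\<close> are functions \<open>x :: nat \<Rightarrow> real\<close>, of which only the entries
  \<open>x 1, \<dots>, x n\<close> are used: the accumulation depends on the order of the entries,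
  and the matching indices are kept 1-based.
\<close>

definition inner_prod :: "nat \<Rightarrow> (nat \<Rightarrow> real) \<Rightarrow> (nat \<Rightarrow> real) \<Rightarrow> real" where
  "inner_prod n x y = (\<Sum>k=1..n. x k * y k)"

text \<open>
  \<open>fl_acc x y d j\<close> is the computed quantity with index \<open>j\<close> when the roundoffs take the values
  \<open>d 1, d 2, \<dots>\<close>.  Odd indices \<open>2k-1\<close> are additions of the \<open>k\<close>-th rounded product; even
  indices are the rounding of the sum just formed.  The value at index 0 is a dummy.
\<close>

fun fl_acc :: "(nat \<Rightarrow> real) \<Rightarrow> (nat \<Rightarrow> real) \<Rightarrow> (nat \<Rightarrow> real) \<Rightarrow> nat \<Rightarrow> real" where
  "fl_acc x y d 0 = 0"
| "fl_acc x y d (Suc 0) = x 1 * y 1"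
| "fl_acc x y d (Suc (Suc m)) =
     (if even m then fl_acc x y d (Suc m) * (1 + d (Suc m))
      else fl_acc x y d (Suc m) + x ((m + 3) div 2) * y ((m + 3) div 2) * (1 + d (Suc m)))"

lemma fl_acc_recursion:
  "fl_acc x y d 1 = x 1 * y 1"
  "fl_acc x y d 2 = fl_acc x y d 1 * (1 + d 1)"
  "2 \<le> k \<Longrightarrow> fl_acc x y d (2*k-1) = fl_acc x y d (2*k-2) + x k * y k * (1 + d (2*k-2))"
  "2 \<le> k \<Longrightarrow> fl_acc x y d (2*k) = fl_acc x y d (2*k-1) * (1 + d (2*k-1))"
proof -
  show "fl_acc x y d 1 = x 1 * y 1" by simp
  show "fl_acc x y d 2 = fl_acc x y d 1 * (1 + d 1)" by (simp add: numeral_2_eq_2)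
  assume "2 \<le> k"
  then obtain i where k: "k = i + 2" by (metis add.commute le_Suc_ex)
  have odd: "2*k-1 = Suc (Suc (2*i+1))" and pred: "2*k-2 = Suc (2*i+1)"
    and even: "2*k = Suc (Suc (2*i+2))" "2*k-1 = Suc (2*i+2)"
    and idx: "(2*i+1+3) div 2 = k"
    using k by auto
  show "fl_acc x y d (2*k-1) = fl_acc x y d (2*k-2) + x k * y k * (1 + d (2*k-2))"
    unfolding odd pred fl_acc.simps idx by simp
  show "fl_acc x y d (2*k) = fl_acc x y d (2*k-1) * (1 + d (2*k-1))"
    unfolding even(2) unfolding even(1) fl_acc.simps by simp
qed

definition fl_inner :: "nat \<Rightarrow> (nat \<Rightarrow> real) \<Rightarrow> (nat \<Rightarrow> real) \<Rightarrow> (nat \<Rightarrow> real) \<Rightarrow> real" where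
  "fl_inner n x y d = fl_acc x y d (2 * n)"

definition err_coeff :: "real \<Rightarrow> (nat \<Rightarrow> real) \<Rightarrow> (nat \<Rightarrow> real) \<Rightarrow> nat \<Rightarrow> real" where
  "err_coeff u x y m =
     (if odd m then
        let k = (m + 1) div 2 in
          \<bar>x 1 * y 1\<bar> * (1 + u) ^ (k - 1) + (\<Sum>j=2..k. \<bar>x j * y j\<bar> * (1 + u) ^ (k - j + 1))
      else
        let k = (m + 2) div 2 in \<bar>x k * y k\<bar>)"

lemma err_coeff_odd:
  "1 \<le> k \<Longrightarrow> err_coeff u x y (2*k-1) =
     \<bar>x 1 * y 1\<bar> * (1 + u) ^ (k - 1) + (\<Sum>j=2..k. \<bar>x j * y j\<bar> * (1 + u) ^ (k - j + 1))"
  by (simp add: err_coeff_def Let_def)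

lemma err_coeff_even:
  "2 \<le> k \<Longrightarrow> err_coeff u x y (2*k-2) = \<bar>x k * y k\<bar>"
proof -
  assume "2 \<le> k"
  then have "(2*k-2+2) div 2 = k" "even (2*k-2)" by auto
  then show ?thesis unfolding err_coeff_def Let_def by simp
qed

text \<open>
  The sigma-algebra on the sample space generated by \<open>\<delta> 1, \<dots>, \<delta> (k-1)\<close>; it is trivial
  for \<open>k = 1\<close>.  Zero mean of the roundoffs is understood relative to these sigma-algebras,
  \<open>E[\<delta> k | \<delta> 1, \<dots>, \<delta> (k-1)] = 0\<close>, which makes the accumulated error a martingale without
  requiring independence.  With \<open>E[\<delta> k] = 0\<close> alone the error bound is false, e.g. for
  \<open>n = 2\<close>, \<open>x = y = (1,1)\<close>, \<open>u = 1/100\<close>, failure probability \<open>9/10\<close> and all \<open>\<delta> k\<close> equal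
  to \<open>u\<close> times one and the same fair random sign.
\<close>

definition roundoff_past :: "'a measure \<Rightarrow> (nat \<Rightarrow> 'a \<Rightarrow> real) \<Rightarrow> nat \<Rightarrow> 'a measure" where
  "roundoff_past M \<delta> k =
     vimage_algebra (space M) (\<lambda>\<omega>. \<lambda>i\<in>{1..<k}. \<delta> i \<omega>) (Pi\<^sub>M {1..<k} (\<lambda>_. borel))"

text \<open>
  The library's \<open>real_cond_exp\<close> is the conditional expectation only relative to a subalgebra
  (otherwise it is identically 0), hence the following check.
\<close>

lemma subalgebra_roundoff_past:
  assumes "\<And>i. i \<in> {1..<k} \<Longrightarrow> \<delta> i \<in> borel_measurable M"
  shows "subalgebra M (roundoff_past M \<delta> k)"
proof -
  have "(\<lambda>\<omega>. \<lambda>i\<in>{1..<k}. \<delta> i \<omega>) \<in> measurable M (Pi\<^sub>M {1..<k} (\<lambda>_. borel))"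
    using assms by (intro measurable_restrict) auto
  then show ?thesis
    unfolding subalgebra_def roundoff_past_def
    by (intro conjI sets_image_in_sets) auto
qed

end

theory Submission
  imports Defs
begin

text \<open>
  The error relative to the exact partial sum picks up one roundoff per step: passing from index \<open>j\<close> to \<open>j + 1\<close>
  changes it by \<open>a j * \<delta> j\<close>, where \<open>a j\<close> is the quantity being rounded, namely the current
  accumulated value for odd \<open>j\<close> and an exact product \<open>x k * y k\<close> for even \<open>j\<close>.  Hence the total
  error is \<open>\<Sum>j. a j * \<delta> j\<close> (\<open>fl_acc_error\<close>).  As \<open>a j\<close> is a function of
  \<open>\<delta> 1, \<dots>, \<delta> (j-1)\<close> only, and \<open>\<delta> j\<close> has conditional mean zero given these, the partial sums
  form a martingale.  Its increments are bounded by \<open>err_coeff u x y j * u\<close>: for even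
  \<open>j\<close> the coefficient is the modulus of the product, and for odd \<open>j\<close> it is what the accumulated
  value becomes in the worst case, with all terms positive and every roundoff equal to \<open>u\<close>
  (\<open>rounded_quantity_bound\<close>).

  The theorem is then the Azuma--Hoeffding inequality
  \<open>P (\<bar>S\<bar> \<ge> t) \<le> 2 * exp (- t\<^sup>2 / (2 * V))\<close> (\<open>Azuma_Hoeffding_ineq_abs_ge\<close>), where \<open>V\<close> is the
  sum of the squared increment bounds, at the \<open>t\<close> that makes the right-hand side equal to the
  failure probability.
  That inequality comes from exponentiating and conditioning on the past.  On \<open>[-b, b]\<close> the convex
  function \<open>exp (l * x)\<close> lies below its chord \<open>cosh (l * b) + x / b * sinh (l * b)\<close>, whose linear
  part has conditional mean zero, so each increment contributes at most a factor
  \<open>cosh (l * b) \<le> exp (l\<^sup>2 * b\<^sup>2 / 2)\<close> to the moment generating function.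
\<close>

section \<open>The Azuma--Hoeffding inequality\<close>

text \<open>
  The logarithm of \<open>cosh h\<close> is the cumulant generating function of a fair random sign, so this is
  the estimate behind Hoeffding's lemma for the interval \<open>[-1, 1]\<close> and probability \<open>1/2\<close>.
\<close>

lemma cosh_le_exp_half_square: "cosh (h::real) \<le> exp (h\<^sup>2 / 2)"
proof -
  have pos: "cosh h \<le> exp (h\<^sup>2 / 2)" if "h \<ge> 0" for h :: real
  proof -
    have "1 + 1/2 * (exp (2*h) - 1) = exp h * cosh h"
      by (simp add: cosh_field_def exp_minus mult_exp_exp field_simps)
    moreover have "- (2*h) * (1/2) + ln (1 + 1/2 * (exp (2*h) - 1)) \<le> (2*h)\<^sup>2 / 8"
      using that by (intro Hoeffdings_lemma_aux) auto
    ultimately have "ln (cosh h) \<le> h\<^sup>2 / 2"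
      by (simp add: ln_mult power2_eq_square)
    then show ?thesis
      by (metis cosh_real_pos exp_le_cancel_iff exp_ln)
  qed
  show ?thesis
    using pos[of h] pos[of "-h"] by (cases "h \<ge> 0") auto
qed

text \<open>For \<open>b = 0\<close> the quotient is \<open>0\<close> by convention and both sides are \<open>1\<close>.\<close>

lemma exp_le_chord:
  fixes x :: real
  assumes "\<bar>x\<bar> \<le> b"
  shows "exp (l * x) \<le> cosh (l * b) + x / b * sinh (l * b)"
proof (cases "b = 0")
  case False
  then have b: "b > 0" using assms by auto
  define t where "t = (x + b) / (2 * b)"
  have t: "0 \<le> t" "t \<le> 1"
    using assms b by (auto simp: t_def field_simps)
  have x: "x = (1 - t) * (-b) + t * b"
    using b by (simp add: t_def field_simps)
  have "exp ((1 - t) *\<^sub>R (l * (-b)) + t *\<^sub>R (l * b))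
          \<le> (1 - t) * exp (l * (-b)) + t * exp (l * b)"
    using t by (intro convex_onD[OF exp_convex]) auto
  also have "(1 - t) *\<^sub>R (l * (-b)) + t *\<^sub>R (l * b) = l * x"
    by (subst x) (simp add: algebra_simps)
  also have "(1 - t) * exp (l * (-b)) + t * exp (l * b)
               = cosh (l * b) + (2 * t - 1) * sinh (l * b)"
    by (simp add: cosh_field_def sinh_field_def field_simps)
  also have "2 * t - 1 = x / b"
    using b by (simp add: t_def field_simps)
  finally show ?thesis .
qed (use assms in auto)

context prob_space
begin

text \<open>
  Hoeffding's lemma conditionally on \<open>F\<close>, tested against a weight \<open>G\<close>; in the induction below
  \<open>G\<close> is the exponential of the martingale so far.
\<close>

lemma expectation_weighted_exp_le:
  fixes X G :: "'a \<Rightarrow> real"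
  assumes F: "subalgebra M F"
    and X [measurable]: "X \<in> borel_measurable M"
    and bound: "AE \<omega> in M. \<bar>X \<omega>\<bar> \<le> b"
    and centred: "AE \<omega> in M. real_cond_exp M F X \<omega> = 0"
    and G: "G \<in> borel_measurable F" "\<And>\<omega>. G \<omega> \<ge> 0" "AE \<omega> in M. G \<omega> \<le> C"
  shows "expectation (\<lambda>\<omega>. G \<omega> * exp (l * X \<omega>)) \<le> exp (l\<^sup>2 * b\<^sup>2 / 2) * expectation G"
proof -
  interpret sigma_finite_subalgebra M F
    by (intro finite_measure_subalgebra_is_sigma_finite finite_measure_subalgebra.intro
          finite_measure_axioms finite_measure_subalgebra_axioms.intro F)
  have GM [measurable]: "G \<in> borel_measurable M"
    using measurable_from_subalg[OF F G(1)] .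
  have int_G: "integrable M G"
    using G by (intro integrable_const_bound[of _ C]) auto
  have int_GX: "integrable M (\<lambda>\<omega>. G \<omega> * X \<omega>)"
  proof (rule integrable_const_bound[of _ "C * b"])
    show "AE \<omega> in M. norm (G \<omega> * X \<omega>) \<le> C * b"
      using G(3) bound
    proof eventually_elim
      case (elim \<omega>)
      have "\<bar>G \<omega>\<bar> * \<bar>X \<omega>\<bar> \<le> C * b"
        using elim G(2)[of \<omega>] by (intro mult_mono) auto
      then show ?case by (simp add: abs_mult)
    qed
  qed auto
  have "expectation (\<lambda>\<omega>. G \<omega> * X \<omega>) = expectation (\<lambda>\<omega>. G \<omega> * real_cond_exp M F X \<omega>)"
    using real_cond_exp_intg(2)[OF int_GX G(1) X] by simp
  also have "\<dots> = expectation (\<lambda>\<omega>. 0)"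
    using centred by (intro integral_cong_AE) auto
  finally have GX_0: "expectation (\<lambda>\<omega>. G \<omega> * X \<omega>) = 0" by simp
  have "expectation (\<lambda>\<omega>. G \<omega> * exp (l * X \<omega>))
      \<le> expectation (\<lambda>\<omega>. cosh (l * b) * G \<omega> + sinh (l * b) / b * (G \<omega> * X \<omega>))"
  proof (rule integral_mono_AE)
    have "AE \<omega> in M. norm (G \<omega> * exp (l * X \<omega>)) \<le> C * exp (\<bar>l\<bar> * b)"
      using G(3) bound
    proof eventually_elim
      case (elim \<omega>)
      have "l * X \<omega> \<le> \<bar>l\<bar> * \<bar>X \<omega>\<bar>"
        by (metis abs_ge_self abs_mult)
      also have "\<dots> \<le> \<bar>l\<bar> * b"
        using elim by (intro mult_left_mono) auto
      finally show ?case
        using elim G(2)[of \<omega>] by (auto simp: abs_mult intro!: mult_mono)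
    qed
    then show "integrable M (\<lambda>\<omega>. G \<omega> * exp (l * X \<omega>))"
      by (intro integrable_const_bound) auto
    show "integrable M (\<lambda>\<omega>. cosh (l * b) * G \<omega> + sinh (l * b) / b * (G \<omega> * X \<omega>))"
      using int_G int_GX by auto
    show "AE \<omega> in M. G \<omega> * exp (l * X \<omega>)
            \<le> cosh (l * b) * G \<omega> + sinh (l * b) / b * (G \<omega> * X \<omega>)"
      using bound
    proof eventually_elim
      case (elim \<omega>)
      from mult_left_mono[OF exp_le_chord[OF elim, of l] G(2)[of \<omega>]] show ?case
        by (simp add: algebra_simps)
    qed
  qed
  also have "\<dots> = cosh (l * b) * expectation G"
    using int_G int_GX GX_0 by simp
  also have "\<dots> \<le> exp (l\<^sup>2 * b\<^sup>2 / 2) * expectation G"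
    using cosh_le_exp_half_square[of "l * b"] G(2)
    by (intro mult_right_mono integral_nonneg) (auto simp: power_mult_distrib)
  finally show ?thesis .
qed

lemma expectation_exp_martingale_le:
  fixes X :: "nat \<Rightarrow> 'a \<Rightarrow> real" and b :: "nat \<Rightarrow> real"
  assumes F: "\<And>k. k \<in> {1..m} \<Longrightarrow> subalgebra M (F k)"
    and X: "\<And>k. k \<in> {1..m} \<Longrightarrow> X k \<in> borel_measurable M"
    and adapted: "\<And>i k. k \<in> {1..m} \<Longrightarrow> i \<in> {1..<k} \<Longrightarrow> X i \<in> borel_measurable (F k)"
    and bound: "\<And>k. k \<in> {1..m} \<Longrightarrow> AE \<omega> in M. \<bar>X k \<omega>\<bar> \<le> b k"
    and centred: "\<And>k. k \<in> {1..m} \<Longrightarrow> AE \<omega> in M. real_cond_exp M (F k) (X k) \<omega> = 0"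
  shows "integrable M (\<lambda>\<omega>. exp (l * (\<Sum>k=1..m. X k \<omega>)))"
    and "expectation (\<lambda>\<omega>. exp (l * (\<Sum>k=1..m. X k \<omega>))) \<le> exp (l\<^sup>2 * (\<Sum>k=1..m. (b k)\<^sup>2) / 2)"
proof -
  have exp_bound: "AE \<omega> in M. exp (l * (\<Sum>k=1..j. X k \<omega>)) \<le> exp (\<bar>l\<bar> * (\<Sum>k=1..j. b k))"
    if "j \<le> m" for j
  proof -
    have "AE \<omega> in M. \<forall>k\<in>{1..j}. \<bar>X k \<omega>\<bar> \<le> b k"
      using bound that by (intro AE_finite_allI) auto
    then show ?thesis
    proof eventually_elim
      case (elim \<omega>)
      have "l * (\<Sum>k=1..j. X k \<omega>) \<le> \<bar>l\<bar> * \<bar>\<Sum>k=1..j. X k \<omega>\<bar>"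
        by (metis abs_ge_self abs_mult)
      also have "\<dots> \<le> \<bar>l\<bar> * (\<Sum>k=1..j. b k)"
        using elim by (intro mult_left_mono order_trans[OF sum_abs] sum_mono) auto
      finally show ?case by simp
    qed
  qed
  have "(\<lambda>\<omega>. \<Sum>k=1..m. X k \<omega>) \<in> borel_measurable M"
    using X by (intro borel_measurable_sum) auto
  then show "integrable M (\<lambda>\<omega>. exp (l * (\<Sum>k=1..m. X k \<omega>)))"
    using exp_bound[of m] by (intro integrable_const_bound) auto
  have "expectation (\<lambda>\<omega>. exp (l * (\<Sum>k=1..j. X k \<omega>))) \<le> exp (l\<^sup>2 * (\<Sum>k=1..j. (b k)\<^sup>2) / 2)"
    if "j \<le> m" for j
    using that
  proof (induction j)
    case 0
    then show ?case by (simp add: prob_space)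
  next
    case (Suc j)
    let ?G = "\<lambda>\<omega>. exp (l * (\<Sum>k=1..j. X k \<omega>))"
    have "(\<lambda>\<omega>. \<Sum>k=1..j. X k \<omega>) \<in> borel_measurable (F (Suc j))"
      using Suc.prems adapted by (intro borel_measurable_sum) auto
    then have G: "?G \<in> borel_measurable (F (Suc j))" by measurable
    have "expectation (\<lambda>\<omega>. exp (l * (\<Sum>k=1..Suc j. X k \<omega>)))
        = expectation (\<lambda>\<omega>. ?G \<omega> * exp (l * X (Suc j) \<omega>))"
      by (simp add: distrib_left exp_add)
    also have "\<dots> \<le> exp (l\<^sup>2 * (b (Suc j))\<^sup>2 / 2) * expectation ?G"
      using Suc.prems exp_bound[of j]
      by (intro expectation_weighted_exp_le[OF F X bound centred G]) auto
    also have "\<dots> \<le> exp (l\<^sup>2 * (b (Suc j))\<^sup>2 / 2) * exp (l\<^sup>2 * (\<Sum>k=1..j. (b k)\<^sup>2) / 2)"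
      using Suc by (intro mult_left_mono) auto
    also have "\<dots> = exp (l\<^sup>2 * (\<Sum>k=1..Suc j. (b k)\<^sup>2) / 2)"
      by (simp add: mult_exp_exp field_simps)
    finally show ?case .
  qed
  then show "expectation (\<lambda>\<omega>. exp (l * (\<Sum>k=1..m. X k \<omega>))) \<le> exp (l\<^sup>2 * (\<Sum>k=1..m. (b k)\<^sup>2) / 2)"
    by simp
qed

theorem Azuma_Hoeffding_ineq_abs_ge:
  fixes X :: "nat \<Rightarrow> 'a \<Rightarrow> real" and b :: "nat \<Rightarrow> real"
  assumes F: "\<And>k. k \<in> {1..m} \<Longrightarrow> subalgebra M (F k)"
    and X: "\<And>k. k \<in> {1..m} \<Longrightarrow> X k \<in> borel_measurable M"
    and adapted: "\<And>i k. k \<in> {1..m} \<Longrightarrow> i \<in> {1..<k} \<Longrightarrow> X i \<in> borel_measurable (F k)"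
    and bound: "\<And>k. k \<in> {1..m} \<Longrightarrow> AE \<omega> in M. \<bar>X k \<omega>\<bar> \<le> b k"
    and centred: "\<And>k. k \<in> {1..m} \<Longrightarrow> AE \<omega> in M. real_cond_exp M (F k) (X k) \<omega> = 0"
    and t: "t \<ge> 0"
    and V_pos: "(\<Sum>k=1..m. (b k)\<^sup>2) > 0"
  shows "prob {\<omega> \<in> space M. \<bar>\<Sum>k=1..m. X k \<omega>\<bar> \<ge> t} \<le> 2 * exp (- t\<^sup>2 / (2 * (\<Sum>k=1..m. (b k)\<^sup>2)))"
proof -
  define V where "V = (\<Sum>k=1..m. (b k)\<^sup>2)"
  define S where "S = (\<lambda>\<omega>. \<Sum>k=1..m. X k \<omega>)"
  have [measurable]: "S \<in> borel_measurable M"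
    unfolding S_def using X by (intro borel_measurable_sum) auto
  have V: "V > 0" using V_pos by (simp add: V_def)
  have tail: "prob {\<omega> \<in> space M. s * S \<omega> \<ge> t} \<le> exp (- t\<^sup>2 / (2 * V))" if s: "s\<^sup>2 = 1" for s
  proof -
    \<comment> \<open>This value minimises \<open>l\<^sup>2 * V / 2 - l * t\<close>, the exponent of the Chernoff bound.\<close>
    define l where "l = t / V"
    have mgf: "integrable M (\<lambda>\<omega>. exp (l * s * S \<omega>))"
        "expectation (\<lambda>\<omega>. exp (l * s * S \<omega>)) \<le> exp ((l * s)\<^sup>2 * V / 2)"
      unfolding S_def V_def
      by (rule expectation_exp_martingale_le[OF F X adapted bound centred]; assumption)+
    have "prob {\<omega> \<in> space M. s * S \<omega> \<ge> t} \<le> prob {\<omega> \<in> space M. exp (l * s * S \<omega>) \<ge> exp (l * t)}"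
      using t V by (intro finite_measure_mono) (auto simp: l_def mult.assoc intro!: mult_left_mono divide_right_mono)
    also have "\<dots> \<le> expectation (\<lambda>\<omega>. exp (l * s * S \<omega>)) / exp (l * t)"
      using mgf(1) by (intro integral_Markov_inequality_measure[where A = "{}"]) auto
    also have "\<dots> \<le> exp (l\<^sup>2 * V / 2) / exp (l * t)"
      using mgf(2) s by (intro divide_right_mono) (auto simp: power_mult_distrib)
    also have "\<dots> = exp (- t\<^sup>2 / (2 * V))"
      using V by (simp add: l_def exp_diff[symmetric] power2_eq_square field_simps)
    finally show ?thesis .
  qed
  have "prob {\<omega> \<in> space M. \<bar>S \<omega>\<bar> \<ge> t}
      \<le> prob ({\<omega> \<in> space M. 1 * S \<omega> \<ge> t} \<union> {\<omega> \<in> space M. (-1) * S \<omega> \<ge> t})"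
    by (intro finite_measure_mono) auto
  also have "\<dots> \<le> prob {\<omega> \<in> space M. 1 * S \<omega> \<ge> t} + prob {\<omega> \<in> space M. (-1) * S \<omega> \<ge> t}"
    by (intro measure_Un_le) auto
  also have "\<dots> \<le> exp (- t\<^sup>2 / (2 * V)) + exp (- t\<^sup>2 / (2 * V))"
    by (intro add_mono tail) auto
  finally show ?thesis
    by (simp add: S_def V_def)
qed

end

section \<open>The error of the accumulation as a weighted sum of roundoffs\<close>

definition rounded_quantity :: "(nat \<Rightarrow> real) \<Rightarrow> (nat \<Rightarrow> real) \<Rightarrow> (nat \<Rightarrow> real) \<Rightarrow> nat \<Rightarrow> real" where
  "rounded_quantity x y d j =
     (if odd j then fl_acc x y d j else x ((j + 2) div 2) * y ((j + 2) div 2))"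

text \<open>At index \<open>m + 1\<close> the accumulation has taken in the first \<open>(m + 2) div 2\<close> products.\<close>

lemma fl_acc_error:
  "fl_acc x y d (Suc m) = inner_prod ((m + 2) div 2) x y
     + (\<Sum>j=1..m. rounded_quantity x y d j * d j)"
proof (induction m)
  case 0
  then show ?case by (simp add: inner_prod_def)
next
  case (Suc m)
  show ?case
  proof (cases "even m")
    case True
    then have "(Suc m + 2) div 2 = (m + 2) div 2" by auto
    with Suc True show ?thesis
      by (simp add: rounded_quantity_def algebra_simps)
  next
    case False
    then obtain i where "m = 2 * i + 1" by (auto elim: oddE)
    with Suc show ?thesis
      by (simp add: rounded_quantity_def inner_prod_def algebra_simps)
  qed
qed

lemma abs_mult_one_plus_le:
  fixes a r u :: real
  assumes "\<bar>r\<bar> \<le> u"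
  shows "\<bar>a * (1 + r)\<bar> \<le> \<bar>a\<bar> * (1 + u)"
  using assms by (auto simp: abs_mult intro!: mult_left_mono)

lemma err_coeff_odd_Suc:
  assumes "1 \<le> k"
  shows "err_coeff u x y (2 * Suc k - 1)
       = (1 + u) * (err_coeff u x y (2 * k - 1) + \<bar>x (Suc k) * y (Suc k)\<bar>)"
proof -
  have "(\<Sum>j=2..Suc k. \<bar>x j * y j\<bar> * (1 + u) ^ (Suc k - j + 1))
      = (\<Sum>j=2..k. \<bar>x j * y j\<bar> * (1 + u) ^ (k - j + 1)) * (1 + u)
        + \<bar>x (Suc k) * y (Suc k)\<bar> * (1 + u)"
    using assms by (auto simp: sum_distrib_right Suc_diff_le intro!: sum.cong)
  moreover have "(1 + u) ^ (Suc k - 1) = (1 + u) ^ (k - 1) * (1 + u)"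
    using assms by (cases k) auto
  ultimately show ?thesis
    using assms by (simp only: err_coeff_odd le_SucI) (simp add: algebra_simps)
qed

lemma fl_acc_odd_bound:
  assumes "1 \<le> k" and "\<And>i. i \<in> {1..<2*k-1} \<Longrightarrow> \<bar>d i\<bar> \<le> u"
  shows "\<bar>fl_acc x y d (2 * k - 1)\<bar> \<le> err_coeff u x y (2 * k - 1)"
  using assms
proof (induction k rule: dec_induct)
  case base
  then show ?case by (simp add: err_coeff_def)
next
  case (step k)
  let ?z = "x (Suc k) * y (Suc k)"
  have d: "\<bar>d (2*k-1)\<bar> \<le> u" "\<bar>d (2*k)\<bar> \<le> u"
    by (rule step.prems, use step.hyps in simp; linarith)+
  have "fl_acc x y d (2*k) = fl_acc x y d (2*k-1) * (1 + d (2*k-1))"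
    using step.hyps fl_acc_recursion(2,4)[where x = x and y = y and d = d] by (cases "k = 1") auto
  then have "fl_acc x y d (2 * Suc k - 1)
      = fl_acc x y d (2*k-1) * (1 + d (2*k-1)) + ?z * (1 + d (2*k))"
    using step.hyps fl_acc_recursion(3)[where k = "Suc k" and x = x and y = y and d = d] by simp
  also have "\<bar>\<dots>\<bar> \<le> \<bar>fl_acc x y d (2*k-1)\<bar> * (1 + u) + \<bar>?z\<bar> * (1 + u)"
    using d by (intro order_trans[OF abs_triangle_ineq] add_mono abs_mult_one_plus_le)
  also have "\<dots> \<le> err_coeff u x y (2*k-1) * (1 + u) + \<bar>?z\<bar> * (1 + u)"
    using step d by (intro add_right_mono mult_right_mono step.IH) auto
  also have "\<dots> = err_coeff u x y (2 * Suc k - 1)"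
    using err_coeff_odd_Suc[OF step.hyps(1)] by (simp add: algebra_simps)
  finally show ?case .
qed

lemma rounded_quantity_bound:
  assumes "1 \<le> j" and "\<And>i. i \<in> {1..<j} \<Longrightarrow> \<bar>d i\<bar> \<le> u"
  shows "\<bar>rounded_quantity x y d j\<bar> \<le> err_coeff u x y j"
proof (cases "odd j")
  case True
  then obtain i where "j = 2 * Suc i - 1" by (auto elim: oddE)
  with assms fl_acc_odd_bound[of "Suc i" d u x y] True show ?thesis
    by (simp add: rounded_quantity_def)
next
  case False
  then show ?thesis by (simp add: rounded_quantity_def err_coeff_def)
qed

lemma err_coeff_nonneg: "0 \<le> u \<Longrightarrow> 0 \<le> err_coeff u x y j"
  by (auto simp: err_coeff_def Let_def intro!: add_nonneg_nonneg sum_nonneg)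

text \<open>
  The coefficients vanish together only if all products do: \<open>\<bar>x 1 * y 1\<bar>\<close> is the first one, and
  the other products are those with even index.
\<close>

lemma sum_err_coeff_pos:
  assumes "inner_prod n x y \<noteq> 0"
  shows "0 < (\<Sum>j=1..2*n-1. (err_coeff u x y j)\<^sup>2)"
proof -
  obtain k where k: "1 \<le> k" "k \<le> n" "x k * y k \<noteq> 0"
    using assms unfolding inner_prod_def
    by (rule sum.not_neutral_contains_not_neutral) (use that in auto)
  define j where "j = (if k = 1 then 1 else 2 * k - 2)"
  have "j \<in> {1..2*n-1}" using k by (auto simp: j_def)
  moreover have "err_coeff u x y j = \<bar>x k * y k\<bar>"
    using k err_coeff_even[of k u x y] by (cases "k = 1") (auto simp: j_def err_coeff_def)
  ultimately show ?thesis
    using k by (intro sum_pos2[of _ j]) auto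
qed

section \<open>The error as a martingale\<close>

lemma borel_measurable_fl_acc:
  assumes "\<And>i. i \<in> {1..<j} \<Longrightarrow> \<delta> i \<in> borel_measurable N"
  shows "(\<lambda>\<omega>. fl_acc x y (\<lambda>k. \<delta> k \<omega>) j) \<in> borel_measurable N"
  using assms
proof (induction j rule: induct_nat_012)
  case (ge2 m)
  have [measurable]: "\<delta> (Suc m) \<in> borel_measurable N"
      "(\<lambda>\<omega>. fl_acc x y (\<lambda>k. \<delta> k \<omega>) (Suc m)) \<in> borel_measurable N"
    using ge2 by auto
  show ?case by (cases "even m") simp_all
qed simp_all

lemma borel_measurable_rounded_quantity:
  assumes "\<And>i. i \<in> {1..<j} \<Longrightarrow> \<delta> i \<in> borel_measurable N"
  shows "(\<lambda>\<omega>. rounded_quantity x y (\<lambda>k. \<delta> k \<omega>) j) \<in> borel_measurable N"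
  using borel_measurable_fl_acc[OF assms] by (simp add: rounded_quantity_def)

lemma borel_measurable_roundoff_past:
  assumes "i \<in> {1..<k}"
  shows "\<delta> i \<in> borel_measurable (roundoff_past M \<delta> k)"
proof -
  have "(\<lambda>\<omega>. \<lambda>i\<in>{1..<k}. \<delta> i \<omega>) \<in> roundoff_past M \<delta> k \<rightarrow>\<^sub>M Pi\<^sub>M {1..<k} (\<lambda>_. borel)"
    unfolding roundoff_past_def
    by (intro measurable_vimage_algebra1) (auto simp: space_PiM)
  from measurable_compose[OF this measurable_component_singleton[OF assms]]
  show ?thesis using assms by simp
qed

theorem theorem4p6:
  fixes M :: "'a measure" and n :: nat and x y :: "nat \<Rightarrow> real" and u p :: real
    and \<delta> :: "nat \<Rightarrow> 'a \<Rightarrow> real"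
  assumes "prob_space M"
    and "inner_prod n x y \<noteq> 0"
    and "0 < u" and "u < 1"
    and "\<And>k. k \<in> {1..2*n-1} \<Longrightarrow> \<delta> k \<in> borel_measurable M"
    and "\<And>k. k \<in> {1..2*n-1} \<Longrightarrow> AE \<omega> in M. \<bar>\<delta> k \<omega>\<bar> \<le> u"
    and "\<And>k. k \<in> {1..2*n-1} \<Longrightarrow> (\<integral>\<omega>. \<delta> k \<omega> \<partial>M) = 0"
    and "\<And>k. k \<in> {1..2*n-1} \<Longrightarrow>
           AE \<omega> in M. real_cond_exp M (roundoff_past M \<delta> k) (\<delta> k) \<omega> = 0"
    and "0 < p" and "p < 1"
  shows "measure M {\<omega> \<in> space M.
             \<bar>(fl_inner n x y (\<lambda>k. \<delta> k \<omega>) - inner_prod n x y) / inner_prod n x y\<bar>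
               \<le> sqrt (\<Sum>k=1..2*n-1. (err_coeff u x y k)\<^sup>2) / \<bar>inner_prod n x y\<bar>
                   * sqrt (2 * ln (2 / p)) * u}
           \<ge> 1 - p"
proof -
  interpret prob_space M by fact
  note meas = assms(5) and bnd = assms(6) and centred = assms(8)
  define m where "m = 2 * n - 1"
  define F where "F = roundoff_past M \<delta>"
  define a where "a = (\<lambda>k \<omega>. rounded_quantity x y (\<lambda>i. \<delta> i \<omega>) k)"
  define X where "X = (\<lambda>k \<omega>. a k \<omega> * \<delta> k \<omega>)"
  define b where "b = (\<lambda>k. err_coeff u x y k * u)"
  define C where "C = (\<Sum>k=1..m. (err_coeff u x y k)\<^sup>2)"
  define t where "t = sqrt C * sqrt (2 * ln (2 / p)) * u"
  define s where "s = inner_prod n x y"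

  have n: "n \<ge> 1"
    using assms(2) by (cases n) (auto simp: inner_prod_def)
  have C: "C > 0"
    using sum_err_coeff_pos[OF assms(2)] by (simp add: C_def m_def)
  have V: "(\<Sum>k=1..m. (b k)\<^sup>2) = C * u\<^sup>2"
    by (simp add: b_def C_def power_mult_distrib sum_distrib_right)
  have ln_pos: "ln (2 / p) > 0"
    using assms(9,10) by simp

  have sub: "subalgebra M (F k)" if "k \<in> {1..m}" for k
    unfolding F_def using that meas by (intro subalgebra_roundoff_past) (auto simp: m_def)
  have a_past: "a k \<in> borel_measurable (F k)" for k
    unfolding a_def F_def
    by (intro borel_measurable_rounded_quantity borel_measurable_roundoff_past)
  have X_meas: "X k \<in> borel_measurable M" if "k \<in> {1..m}" for k
    using that meas measurable_from_subalg[OF sub[OF that] a_past]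
    by (auto simp: X_def m_def intro!: borel_measurable_times)
  have X_adapted: "X i \<in> borel_measurable (F k)" if "i \<in> {1..<k}" for i k
  proof -
    have "a i \<in> borel_measurable (F k)"
      unfolding a_def F_def using that
      by (intro borel_measurable_rounded_quantity borel_measurable_roundoff_past) auto
    then show ?thesis
      using borel_measurable_roundoff_past[OF that, of \<delta> M]
      by (auto simp: X_def F_def intro!: borel_measurable_times)
  qed
  have X_bound: "AE \<omega> in M. \<bar>X k \<omega>\<bar> \<le> b k" if "k \<in> {1..m}" for k
  proof -
    have "AE \<omega> in M. \<forall>i\<in>{1..k}. \<bar>\<delta> i \<omega>\<bar> \<le> u"
      using bnd that by (intro AE_finite_allI) (auto simp: m_def)
    then show ?thesis
    proof eventually_elim
      case (elim \<omega>)
      with that show ?case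
        unfolding X_def b_def a_def abs_mult
        by (intro mult_mono rounded_quantity_bound err_coeff_nonneg) (use assms(3) in auto)
    qed
  qed
  have X_centred: "AE \<omega> in M. real_cond_exp M (F k) (X k) \<omega> = 0" if k: "k \<in> {1..m}" for k
  proof -
    interpret sigma_finite_subalgebra M "F k"
      by (intro finite_measure_subalgebra_is_sigma_finite finite_measure_subalgebra.intro
            finite_measure_axioms finite_measure_subalgebra_axioms.intro sub k)
    have "integrable M (X k)"
      using X_bound[OF k] X_meas[OF k] by (intro integrable_const_bound) auto
    then have "AE \<omega> in M. real_cond_exp M (F k) (X k) \<omega> = a k \<omega> * real_cond_exp M (F k) (\<delta> k) \<omega>"
      unfolding X_def using k meas by (intro real_cond_exp_mult a_past) (auto simp: m_def)
    moreover have "AE \<omega> in M. real_cond_exp M (F k) (\<delta> k) \<omega> = 0"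
      using centred k by (auto simp: m_def F_def)
    ultimately show ?thesis by eventually_elim simp
  qed

  have err: "fl_inner n x y (\<lambda>k. \<delta> k \<omega>) - s = (\<Sum>k=1..m. X k \<omega>)" for \<omega>
  proof -
    have "2 * n = Suc m" "(m + 2) div 2 = n" using n by (auto simp: m_def)
    then show ?thesis
      using fl_acc_error[of x y "\<lambda>k. \<delta> k \<omega>" m]
      by (simp add: fl_inner_def s_def X_def a_def)
  qed
  define S where "S = (\<lambda>\<omega>. \<Sum>k=1..m. X k \<omega>)"
  let ?good = "{\<omega> \<in> space M. \<bar>S \<omega>\<bar> \<le> t}"
  let ?bad = "{\<omega> \<in> space M. \<bar>S \<omega>\<bar> \<ge> t}"
  have [measurable]: "S \<in> borel_measurable M"
    unfolding S_def using X_meas by (intro borel_measurable_sum) auto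
  have "prob ?bad \<le> 2 * exp (- t\<^sup>2 / (2 * (\<Sum>k=1..m. (b k)\<^sup>2)))"
    unfolding S_def using C V ln_pos assms(3)
    by (intro Azuma_Hoeffding_ineq_abs_ge[OF sub X_meas X_adapted X_bound X_centred])
       (auto simp: t_def)
  also have "t\<^sup>2 / (2 * (\<Sum>k=1..m. (b k)\<^sup>2)) = ln (2 / p)"
    using C ln_pos assms(3) unfolding V t_def by (simp add: power_mult_distrib)
  then have "2 * exp (- t\<^sup>2 / (2 * (\<Sum>k=1..m. (b k)\<^sup>2))) = p"
    using assms(9) by (simp add: exp_minus)
  finally have "prob ?bad \<le> p" .
  moreover have "?bad \<in> events"
    by measurable
  ultimately have "1 - p \<le> prob (space M - ?bad)"
    by (simp only: prob_compl)
  also have "\<dots> \<le> prob ?good"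
    by (intro finite_measure_mono) auto
  also have "?good = {\<omega> \<in> space M.
      \<bar>(fl_inner n x y (\<lambda>k. \<delta> k \<omega>) - s) / s\<bar> \<le> sqrt C / \<bar>s\<bar> * sqrt (2 * ln (2 / p)) * u}"
    using assms(2) by (simp add: err S_def t_def abs_divide divide_le_cancel flip: s_def)
  finally show ?thesis
    by (simp only: s_def C_def m_def)
qed

end
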